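(* Let $L$ be any of the fifteen logics of the modal cube and $\mathcal M_L$ its Nmatrix. For every level-valuation $v\in L(\mathcal M_L)$ and every set of formulas $\Lambda$ closed under subformulas, the restriction $v|_\Lambda$ of $v$ to $\Lambda$ is a partial level-valuation.
   Context: Syntax and logics. Formulas: $\alpha ::= p \mid \bot \mid \alpha\to\alpha \mid \Box\alpha$; $\mathrm{For}$ is the set of formulas; $\neg\alpha:=\alpha\to\bot$, $\Diamond\alpha:=\neg\Box\neg\alpha$. $\mathbf K$: classical propositional axioms, (k) $\Box(\alpha\to\beta)\to(\Box\alpha\to\Box\beta)$, modus ponens, necessitation. Axiom schemes (D) $\Box\alpha\to\Diamond\alpha$, (T) $\Box\alpha\to\alpha$, (B) $\alpha\to\Box\Diamond\alpha$, (4) $\Box\alpha\to\Box\Box\alpha$, (5) $\Diamond\alpha\to\Box\Diamond\alpha$. The modal cube: $\mathbf K,\mathbf{KB},\mathbf{K4},\mathbf{K5},\mathbf{K45},\mathbf{KD},\mathbf{KDB},\mathbf{KD4},\mathbf{KD5},\mathbf{KD45},\mathbf{KT},\mathbf{KTB},\mathbf{S4}=\mathbf{KT4},\mathbf{S5}=\mathbf{KTB45},\mathbf{KB5}=\mathbf{KB45}$. Truth values $\mathbf{F},\mathbf{f},\mathbf{f}_2,\mathbf{f}_3,\mathbf{t}_3,\mathbf{t}_2,\mathbf{t},\mathbf{T}$. Distinguished sets: $\mathcal D=\{\mathbf T,\mathbf t,\mathbf t_2,\mathbf t_3\}$ (designated), $N=\{\mathbf T,\mathbf t_2,\mathbf f_3,\mathbf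 f_2\}$, $I=\{\mathbf F,\mathbf f_2,\mathbf t_3,\mathbf t_2\}$, $P=\{\mathbf T,\mathbf t,\mathbf f_3,\mathbf f\}$, $PN=\{\mathbf F,\mathbf f,\mathbf t_3,\mathbf t\}$. Nmatrix $\mathcal M_L$. Values $V(L)$: all eight values for $\mathbf K,\mathbf{KB},\mathbf{K4},\mathbf{K5},\mathbf{K45}$; $\{\mathbf F,\mathbf f,\mathbf f_2,\mathbf t_2,\mathbf t,\mathbf T\}$ for $\mathbf{KB5}$; $\{\mathbf F,\mathbf f,\mathbf f_3,\mathbf t_3,\mathbf t,\mathbf T\}$ for $\mathbf{KD},\mathbf{KDB},\mathbf{KD4},\mathbf{KD5},\mathbf{KD45}$; $\{\mathbf F,\mathbf f,\mathbf t,\mathbf T\}$ for $\mathbf{KT},\mathbf{KTB},\mathbf{S4},\mathbf{S5}$. $\tilde\bot=\{\mathbf F,\mathbf f_2\}$. $\tilde\to(x,y)$, restricted to arguments in $V(L)$, listed for $y=\mathbf F,\mathbf f,\mathbf f_2,\mathbf f_3,\mathbf t_3,\mathbf t_2,\mathbf t,\mathbf T$: $x=\mathbf F$: $\{\mathbf T\}$ for all $y$; $x=\mathbf f$: $\{\mathbf t\},\{\mathbf T,\mathbf t\},\{\mathbf t_2\},\{\mathbf T\},\{\mathbf t\},\{\mathbf T\},\{\mathbf T,\mathbf t\},\{\mathbf T\}$; $x=\mathbf f_2$ and $x=\mathbf f_3$: $\{\mathbf t_3\},\{\mathbf t\},\{\mathbf t_2\},\{\mathbf T\},\{\mathbf t_3\},\{\mathbf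 t_2\},\{\mathbf t\},\{\mathbf T\}$; $x=\mathbf t_3$: $\{\mathbf f_3\}$ for $y\in\{\mathbf F,\mathbf f,\mathbf f_2,\mathbf f_3\}$, $\{\mathbf T\}$ otherwise; $x=\mathbf t_2$: $\{\mathbf F\},\{\mathbf f\},\{\mathbf f_2\},\{\mathbf f_3\},\{\mathbf t_3\},\{\mathbf t_2\},\{\mathbf t_3\},\{\mathbf T\}$; $x=\mathbf t$: $\{\mathbf f\},\{\mathbf f,\mathbf f_3\},\{\mathbf f_3\},\{\mathbf f_3\},\{\mathbf t\},\{\mathbf T\},\{\mathbf T,\mathbf t\},\{\mathbf T\}$; $x=\mathbf T$: $\{\mathbf F\},\{\mathbf f\},\{\mathbf f_2\},\{\mathbf f_3\},\{\mathbf t_3\},\{\mathbf t_2\},\{\mathbf t\},\{\mathbf T\}$. $\tilde\Box$ (argument $\mapsto$ output): $\mathbf K$: $\mathbf F,\mathbf f,\mathbf t_3,\mathbf t\mapsto\{\mathbf F,\mathbf f,\mathbf f_3\}$; $\mathbf f_2,\mathbf t_2\mapsto\{\mathbf t_2\}$; $\mathbf f_3,\mathbf T\mapsto\{\mathbf T,\mathbf t,\mathbf t_3\}$. $\mathbf{KB}$: $\mathbf F,\mathbf f\mapsto\{\mathbf F\}$; $\mathbf f_2,\mathbf t_2\mapsto\{\mathbf t_2\}$; $\mathbf f_3\mapsto\{\mathbf t_3\}$; $\mathbf t_3,\mathbf t\mapsto\{\mathbf F,\mathbf f,\mathbf f_3\}$; $\mathbf T\mapsto\{\mathbf T,\mathbf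 t,\mathbf t_3\}$. $\mathbf{K4}$: $\mathbf F,\mathbf f,\mathbf t_3,\mathbf t\mapsto\{\mathbf F,\mathbf f,\mathbf f_3\}$; $\mathbf f_2,\mathbf t_2\mapsto\{\mathbf t_2\}$; $\mathbf f_3,\mathbf T\mapsto\{\mathbf T\}$. $\mathbf{K5}$: $\mathbf F,\mathbf f,\mathbf t_3,\mathbf t\mapsto\{\mathbf F\}$; $\mathbf f_2,\mathbf t_2\mapsto\{\mathbf t_2\}$; $\mathbf f_3,\mathbf T\mapsto\{\mathbf T,\mathbf t_3\}$. $\mathbf{K45}$: $\mathbf F,\mathbf f,\mathbf t_3,\mathbf t\mapsto\{\mathbf F\}$; $\mathbf f_2,\mathbf t_2\mapsto\{\mathbf t_2\}$; $\mathbf f_3,\mathbf T\mapsto\{\mathbf T\}$. $\mathbf{KB5}$: $\mathbf F,\mathbf f,\mathbf t\mapsto\{\mathbf F\}$; $\mathbf f_2,\mathbf t_2\mapsto\{\mathbf t_2\}$; $\mathbf T\mapsto\{\mathbf T\}$. $\mathbf{KD}$: $\mathbf F,\mathbf f,\mathbf t_3,\mathbf t\mapsto\{\mathbf F,\mathbf f,\mathbf f_3\}$; $\mathbf f_3,\mathbf T\mapsto\{\mathbf T,\mathbf t,\mathbf t_3\}$. $\mathbf{KDB}$: $\mathbf F,\mathbf f\mapsto\{\mathbf F\}$; $\mathbf f_3\mapsto\{\mathbf t_3\}$; $\mathbf t_3,\mathbf t\mapsto\{\mathbf F,\mathbf f,\mathbf f_3\}$; $\mathbf T\mapsto\{\mathbf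 T,\mathbf t,\mathbf t_3\}$. $\mathbf{KD4}$: $\mathbf F,\mathbf t_3\mapsto\{\mathbf F\}$; $\mathbf f,\mathbf t\mapsto\{\mathbf F,\mathbf f,\mathbf f_3\}$; $\mathbf f_3,\mathbf T\mapsto\{\mathbf T\}$. $\mathbf{KD5}$: $\mathbf F,\mathbf f,\mathbf t_3,\mathbf t\mapsto\{\mathbf F\}$; $\mathbf f_3,\mathbf T\mapsto\{\mathbf T,\mathbf t_3\}$. $\mathbf{KD45}$: $\mathbf F,\mathbf f,\mathbf t_3,\mathbf t\mapsto\{\mathbf F\}$; $\mathbf f_3,\mathbf T\mapsto\{\mathbf T\}$. $\mathbf{KT}$: $\mathbf F\mapsto\{\mathbf F\}$; $\mathbf f,\mathbf t\mapsto\{\mathbf F,\mathbf f\}$; $\mathbf T\mapsto\{\mathbf T,\mathbf t\}$. $\mathbf{KTB}$: $\mathbf F,\mathbf f\mapsto\{\mathbf F\}$; $\mathbf t\mapsto\{\mathbf F,\mathbf f\}$; $\mathbf T\mapsto\{\mathbf T,\mathbf t\}$. $\mathbf{S4}$: $\mathbf F\mapsto\{\mathbf F\}$; $\mathbf f,\mathbf t\mapsto\{\mathbf F,\mathbf f\}$; $\mathbf T\mapsto\{\mathbf T\}$. $\mathbf{S5}$: $\mathbf F,\mathbf f,\mathbf t\mapsto\{\mathbf F\}$; $\mathbf T\mapsto\{\mathbf T\}$. Partial valuations: for $\Lambda$ closed under subformulas, $[\Lambda\to V]_{\mathcal M_L}$ is the set of maps $v:\Lambda\to V(L)$ with $v(\bot)\in\tilde\bot$,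 $v(\beta\to\gamma)\in\tilde\to(v(\beta),v(\gamma))$, $v(\Box\beta)\in\tilde\Box(v(\beta))$ whenever these formulas lie in $\Lambda$. A valuation is such a map with $\Lambda=\mathrm{For}$; $\mathrm{Val}(\mathcal M_L)$ is the set of valuations. Level valuations: $L_0(\mathcal M_L)$ is the set of $v\in\mathrm{Val}(\mathcal M_L)$ such that, if $v(\beta)\in\{\mathbf f_2,\mathbf t_2\}$ for some $\beta$, then $v(\gamma)\in\{\mathbf f_2,\mathbf t_2\}$ for all $\gamma$. $L_{n+1}(\mathcal M_L)=\{v\in L_n(\mathcal M_L)\mid$ for all $\beta$, if $w(\beta)\in\mathcal D$ for every $w\in L_n(\mathcal M_L)$, then $v(\beta)\in\{\mathbf T,\mathbf t_2\}\}$. The level-valuations are $L(\mathcal M_L)=\bigcap_{n\ge0}L_n(\mathcal M_L)$. Models: a pre-model on $\Lambda$ is a pair $\langle\Pi,R\rangle$ with $\Pi\subseteq[\Lambda\to V]_{\mathcal M_L}$ and $R\subseteq\Pi\times\Pi$ such that for all $v\in\Pi$, $\beta\in\Lambda$: if $v(\beta)\in P$ there is $w\in\Pi$ with $vRw$ and $w(\beta)\in\mathcal D$; if $v(\beta)\in PN$ there is $w\in\Pi$ with $vRw$ and $w(\beta)\notin\mathcal D$. A $\mathbf K$-model is a pre-model such that whenever $vRw$: $v(\beta)\in N\Rightarrow w(\beta)\in\mathcal D$ and $v(\beta)\in I\Rightarrow w(\beta)\notin\mathcal D$. An $L$-model is a $\mathbf K$-model satisfying, for each axiom scheme among (T),(D),(B),(4),(5)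 that holds in $L$, the following conditions for all $v,w,w'\in\Pi$, $\beta\in\Lambda$: (T): $v(\beta)\in N\Rightarrow v(\beta)\in\mathcal D$, and $v(\beta)\in I\Rightarrow v(\beta)\notin\mathcal D$; (D): $v(\beta)\in N\Rightarrow v(\beta)\in P$, and $v(\beta)\in I\Rightarrow v(\beta)\in PN$; (B): if $vRw$, then $v(\beta)\in\mathcal D\Rightarrow w(\beta)\in P$ and $v(\beta)\notin\mathcal D\Rightarrow w(\beta)\in PN$; (4): if $vRw$, then $v(\beta)\in N\Rightarrow w(\beta)\in N$ and $v(\beta)\in I\Rightarrow w(\beta)\in I$; (5): if $vRw$, then $v(\beta)\in P\Rightarrow w(\beta)\in P$ and $v(\beta)\in PN\Rightarrow w(\beta)\in PN$; moreover if $v(\beta),w(\beta)\in N$, $vRw$ and ($vRw'$ or $wRw'$) then $w'(\beta)\in N$, and likewise with $I$ in place of $N$. A partial valuation $v$ is a partial level-valuation (for $L$) if $v\in\Pi$ for some $L$-model $\langle\Pi,R\rangle$. *)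

theory Defs
  imports Main "HOL-Library.FuncSet"
begin

section \<open>Formulas and the modal cube\<close>

datatype 'p fm =
    Atom 'p
  | Bot
  | Imp "'p fm" "'p fm"  (infixr "\<^bold>\<rightarrow>" 60)
  | Box "'p fm"

definition Neg :: "'p fm \<Rightarrow> 'p fm" where
  "Neg \<alpha> = (\<alpha> \<^bold>\<rightarrow> Bot)"

definition Dia :: "'p fm \<Rightarrow> 'p fm" where
  "Dia \<alpha> = Neg (Box (Neg \<alpha>))"

fun subfms :: "'p fm \<Rightarrow> 'p fm set" where
  "subfms (Atom p) = {Atom p}"
| "subfms Bot = {Bot}"
| "subfms (\<alpha> \<^bold>\<rightarrow> \<beta>) = insert (\<alpha> \<^bold>\<rightarrow> \<beta>) (subfms \<alpha> \<union> subfms \<beta>)"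
| "subfms (Box \<alpha>) = insert (Box \<alpha>) (subfms \<alpha>)"

definition closed_subfms :: "'p fm set \<Rightarrow> bool" where
  "closed_subfms \<Lambda> \<longleftrightarrow> (\<forall>\<alpha>\<in>\<Lambda>. subfms \<alpha> \<subseteq> \<Lambda>)"

datatype scheme = AxD | AxT | AxB | Ax4 | Ax5

fun instances :: "scheme \<Rightarrow> 'p fm set" where
  "instances AxD = {Box \<alpha> \<^bold>\<rightarrow> Dia \<alpha> | \<alpha>. True}"
| "instances AxT = {Box \<alpha> \<^bold>\<rightarrow> \<alpha> | \<alpha>. True}"
| "instances AxB = {\<alpha> \<^bold>\<rightarrow> Box (Dia \<alpha>) | \<alpha>. True}"
| "instances Ax4 = {Box \<alpha> \<^bold>\<rightarrow> Box (Box \<alpha>) | \<alpha>. True}"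
| "instances Ax5 = {Dia \<alpha> \<^bold>\<rightarrow> Box (Dia \<alpha>) | \<alpha>. True}"

datatype modal_logic =
  K | KB | K4 | K5 | K45 | KD | KDB | KD4 | KD5 | KD45 | KT | KTB | S4 | S5 | KB5

text \<open>
  Axiom schemes added to K. Note S4 = KT4, S5 = KTB45 and KB5 = KB45. A logic may derive schemes
  that are not listed here, e.g. (D) in KT.
\<close>

fun schemes :: "modal_logic \<Rightarrow> scheme set" where
  "schemes K = {}"
| "schemes KB = {AxB}"
| "schemes K4 = {Ax4}"
| "schemes K5 = {Ax5}"
| "schemes K45 = {Ax4, Ax5}"
| "schemes KD = {AxD}"
| "schemes KDB = {AxD, AxB}"
| "schemes KD4 = {AxD, Ax4}"
| "schemes KD5 = {AxD, Ax5}"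
| "schemes KD45 = {AxD, Ax4, Ax5}"
| "schemes KT = {AxT}"
| "schemes KTB = {AxT, AxB}"
| "schemes S4 = {AxT, Ax4}"
| "schemes S5 = {AxT, AxB, Ax4, Ax5}"
| "schemes KB5 = {AxB, Ax4, Ax5}"

inductive_set theorems :: "modal_logic \<Rightarrow> 'p fm set" for L :: modal_logic where
  ax_weaken: "\<alpha> \<^bold>\<rightarrow> \<beta> \<^bold>\<rightarrow> \<alpha> \<in> theorems L"
| ax_distr: "(\<alpha> \<^bold>\<rightarrow> \<beta> \<^bold>\<rightarrow> \<gamma>) \<^bold>\<rightarrow> (\<alpha> \<^bold>\<rightarrow> \<beta>) \<^bold>\<rightarrow> \<alpha> \<^bold>\<rightarrow> \<gamma> \<in> theorems L"
| ax_dneg: "Neg (Neg \<alpha>) \<^bold>\<rightarrow> \<alpha> \<in> theorems L"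
| ax_k: "Box (\<alpha> \<^bold>\<rightarrow> \<beta>) \<^bold>\<rightarrow> Box \<alpha> \<^bold>\<rightarrow> Box \<beta> \<in> theorems L"
| ax_scheme: "S \<in> schemes L \<Longrightarrow> \<alpha> \<in> instances S \<Longrightarrow> \<alpha> \<in> theorems L"
| mp: "\<alpha> \<^bold>\<rightarrow> \<beta> \<in> theorems L \<Longrightarrow> \<alpha> \<in> theorems L \<Longrightarrow> \<beta> \<in> theorems L"
| nec: "\<alpha> \<in> theorems L \<Longrightarrow> Box \<alpha> \<in> theorems L"

section \<open>The Nmatrices\<close>

datatype tval = VF | Vf | Vf2 | Vf3 | Vt3 | Vt2 | Vt | VT

definition Des :: "tval set" where "Des = {VT, Vt, Vt2, Vt3}"
definition Nset :: "tval set" where "Nset = {VT, Vt2, Vf3, Vf2}"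
definition Iset :: "tval set" where "Iset = {VF, Vf2, Vt3, Vt2}"
definition Pset :: "tval set" where "Pset = {VT, Vt, Vf3, Vf}"
definition PNset :: "tval set" where "PNset = {VF, Vf, Vt3, Vt}"

definition vals :: "modal_logic \<Rightarrow> tval set" where
  "vals L =
    (if L \<in> {K, KB, K4, K5, K45} then {VF, Vf, Vf2, Vf3, Vt3, Vt2, Vt, VT}
     else if L = KB5 then {VF, Vf, Vf2, Vt2, Vt, VT}
     else if L \<in> {KD, KDB, KD4, KD5, KD45} then {VF, Vf, Vf3, Vt3, Vt, VT}
     else {VF, Vf, Vt, VT})"

definition bot_tt :: "tval set" where "bot_tt = {VF, Vf2}"

text \<open>
  One eight-valued table serves all logics: valuations take their values in \<^term>\<open>vals L\<close>,
  which restricts the table to these arguments.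
\<close>

fun imp_tt :: "tval \<Rightarrow> tval \<Rightarrow> tval set" where
  "imp_tt VF y = {VT}"
| "imp_tt Vf y =
    (case y of VF \<Rightarrow> {Vt} | Vf \<Rightarrow> {VT, Vt} | Vf2 \<Rightarrow> {Vt2} | Vf3 \<Rightarrow> {VT}
             | Vt3 \<Rightarrow> {Vt} | Vt2 \<Rightarrow> {VT} | Vt \<Rightarrow> {VT, Vt} | VT \<Rightarrow> {VT})"
| "imp_tt Vf2 y =
    (case y of VF \<Rightarrow> {Vt3} | Vf \<Rightarrow> {Vt} | Vf2 \<Rightarrow> {Vt2} | Vf3 \<Rightarrow> {VT}
             | Vt3 \<Rightarrow> {Vt3} | Vt2 \<Rightarrow> {Vt2} | Vt \<Rightarrow> {Vt} | VT \<Rightarrow> {VT})"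
| "imp_tt Vf3 y =
    (case y of VF \<Rightarrow> {Vt3} | Vf \<Rightarrow> {Vt} | Vf2 \<Rightarrow> {Vt2} | Vf3 \<Rightarrow> {VT}
             | Vt3 \<Rightarrow> {Vt3} | Vt2 \<Rightarrow> {Vt2} | Vt \<Rightarrow> {Vt} | VT \<Rightarrow> {VT})"
| "imp_tt Vt3 y = (if y \<in> {VF, Vf, Vf2, Vf3} then {Vf3} else {VT})"
| "imp_tt Vt2 y =
    (case y of VF \<Rightarrow> {VF} | Vf \<Rightarrow> {Vf} | Vf2 \<Rightarrow> {Vf2} | Vf3 \<Rightarrow> {Vf3}
             | Vt3 \<Rightarrow> {Vt3} | Vt2 \<Rightarrow> {Vt2} | Vt \<Rightarrow> {Vt3} | VT \<Rightarrow> {VT})"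
| "imp_tt Vt y =
    (case y of VF \<Rightarrow> {Vf} | Vf \<Rightarrow> {Vf, Vf3} | Vf2 \<Rightarrow> {Vf3} | Vf3 \<Rightarrow> {Vf3}
             | Vt3 \<Rightarrow> {Vt} | Vt2 \<Rightarrow> {VT} | Vt \<Rightarrow> {VT, Vt} | VT \<Rightarrow> {VT})"
| "imp_tt VT y =
    (case y of VF \<Rightarrow> {VF} | Vf \<Rightarrow> {Vf} | Vf2 \<Rightarrow> {Vf2} | Vf3 \<Rightarrow> {Vf3}
             | Vt3 \<Rightarrow> {Vt3} | Vt2 \<Rightarrow> {Vt2} | Vt \<Rightarrow> {Vt} | VT \<Rightarrow> {VT})"

text \<open>The value \<^term>\<open>{}\<close> is a dummy for arguments outside \<^term>\<open>vals L\<close>.\<close>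

fun box_tt :: "modal_logic \<Rightarrow> tval \<Rightarrow> tval set" where
  "box_tt K x =
    (if x \<in> {VF, Vf, Vt3, Vt} then {VF, Vf, Vf3}
     else if x \<in> {Vf2, Vt2} then {Vt2}
     else {VT, Vt, Vt3})"
| "box_tt KB x =
    (if x \<in> {VF, Vf} then {VF}
     else if x \<in> {Vf2, Vt2} then {Vt2}
     else if x = Vf3 then {Vt3}
     else if x \<in> {Vt3, Vt} then {VF, Vf, Vf3}
     else {VT, Vt, Vt3})"
| "box_tt K4 x =
    (if x \<in> {VF, Vf, Vt3, Vt} then {VF, Vf, Vf3}
     else if x \<in> {Vf2, Vt2} then {Vt2}
     else {VT})"
| "box_tt K5 x =
    (if x \<in> {VF, Vf, Vt3, Vt} then {VF}
     else if x \<in> {Vf2, Vt2} then {Vt2}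
     else {VT, Vt3})"
| "box_tt K45 x =
    (if x \<in> {VF, Vf, Vt3, Vt} then {VF}
     else if x \<in> {Vf2, Vt2} then {Vt2}
     else {VT})"
| "box_tt KB5 x =
    (if x \<in> {VF, Vf, Vt} then {VF}
     else if x \<in> {Vf2, Vt2} then {Vt2}
     else if x = VT then {VT}
     else {})"
| "box_tt KD x =
    (if x \<in> {VF, Vf, Vt3, Vt} then {VF, Vf, Vf3}
     else if x \<in> {Vf3, VT} then {VT, Vt, Vt3}
     else {})"
| "box_tt KDB x =
    (if x \<in> {VF, Vf} then {VF}
     else if x = Vf3 then {Vt3}
     else if x \<in> {Vt3, Vt} then {VF, Vf, Vf3}
     else if x = VT then {VT, Vt, Vt3}
     else {})"
| "box_tt KD4 x =
    (if x \<in> {VF, Vt3} then {VF}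
     else if x \<in> {Vf, Vt} then {VF, Vf, Vf3}
     else if x \<in> {Vf3, VT} then {VT}
     else {})"
| "box_tt KD5 x =
    (if x \<in> {VF, Vf, Vt3, Vt} then {VF}
     else if x \<in> {Vf3, VT} then {VT, Vt3}
     else {})"
| "box_tt KD45 x =
    (if x \<in> {VF, Vf, Vt3, Vt} then {VF}
     else if x \<in> {Vf3, VT} then {VT}
     else {})"
| "box_tt KT x =
    (if x = VF then {VF}
     else if x \<in> {Vf, Vt} then {VF, Vf}
     else if x = VT then {VT, Vt}
     else {})"
| "box_tt KTB x =
    (if x \<in> {VF, Vf} then {VF}
     else if x = Vt then {VF, Vf}
     else if x = VT then {VT, Vt}
     else {})"
| "box_tt S4 x =
    (if x = VF then {VF}
     else if x \<in> {Vf, Vt} then {VF, Vf}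
     else if x = VT then {VT}
     else {})"
| "box_tt S5 x =
    (if x \<in> {VF, Vf, Vt} then {VF}
     else if x = VT then {VT}
     else {})"

section \<open>Valuations and level-valuations\<close>

definition partial_vals :: "modal_logic \<Rightarrow> 'p fm set \<Rightarrow> ('p fm \<Rightarrow> tval) set" where
  "partial_vals L \<Lambda> =
    {v \<in> \<Lambda> \<rightarrow>\<^sub>E vals L.
      (Bot \<in> \<Lambda> \<longrightarrow> v Bot \<in> bot_tt) \<and>
      (\<forall>\<beta> \<gamma>. (\<beta> \<^bold>\<rightarrow> \<gamma>) \<in> \<Lambda> \<longrightarrow> v (\<beta> \<^bold>\<rightarrow> \<gamma>) \<in> imp_tt (v \<beta>) (v \<gamma>)) \<and>
      (\<forall>\<beta>. Box \<beta> \<in> \<Lambda> \<longrightarrow> v (Box \<beta>) \<in> box_tt L (v \<beta>))}"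

definition valuations :: "modal_logic \<Rightarrow> ('p fm \<Rightarrow> tval) set" where
  "valuations L = partial_vals L UNIV"

fun level :: "modal_logic \<Rightarrow> nat \<Rightarrow> ('p fm \<Rightarrow> tval) set" where
  "level L 0 =
    {v \<in> valuations L. (\<exists>\<beta>. v \<beta> \<in> {Vf2, Vt2}) \<longrightarrow> (\<forall>\<gamma>. v \<gamma> \<in> {Vf2, Vt2})}"
| "level L (Suc n) =
    {v \<in> level L n. \<forall>\<beta>. (\<forall>w \<in> level L n. w \<beta> \<in> Des) \<longrightarrow> v \<beta> \<in> {VT, Vt2}}"

definition level_valuations :: "modal_logic \<Rightarrow> ('p fm \<Rightarrow> tval) set" where
  "level_valuations L = (\<Inter>n. level L n)"

section \<open>Models and partial level-valuations\<close>

definition pre_model ::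
  "modal_logic \<Rightarrow> 'p fm set \<Rightarrow> ('p fm \<Rightarrow> tval) set \<Rightarrow> ('p fm \<Rightarrow> tval) rel \<Rightarrow> bool" where
  "pre_model L \<Lambda> W R \<longleftrightarrow>
    closed_subfms \<Lambda> \<and> W \<subseteq> partial_vals L \<Lambda> \<and> R \<subseteq> W \<times> W \<and>
    (\<forall>v\<in>W. \<forall>\<beta>\<in>\<Lambda>.
      (v \<beta> \<in> Pset \<longrightarrow> (\<exists>w\<in>W. (v, w) \<in> R \<and> w \<beta> \<in> Des)) \<and>
      (v \<beta> \<in> PNset \<longrightarrow> (\<exists>w\<in>W. (v, w) \<in> R \<and> w \<beta> \<notin> Des)))"

definition K_model ::
  "modal_logic \<Rightarrow> 'p fm set \<Rightarrow> ('p fm \<Rightarrow> tval) set \<Rightarrow> ('p fm \<Rightarrow> tval) rel \<Rightarrow> bool" where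
  "K_model L \<Lambda> W R \<longleftrightarrow>
    pre_model L \<Lambda> W R \<and>
    (\<forall>v\<in>W. \<forall>w\<in>W. \<forall>\<beta>\<in>\<Lambda>. (v, w) \<in> R \<longrightarrow>
      (v \<beta> \<in> Nset \<longrightarrow> w \<beta> \<in> Des) \<and> (v \<beta> \<in> Iset \<longrightarrow> w \<beta> \<notin> Des))"

fun scheme_cond ::
  "scheme \<Rightarrow> 'p fm set \<Rightarrow> ('p fm \<Rightarrow> tval) set \<Rightarrow> ('p fm \<Rightarrow> tval) rel \<Rightarrow> bool" where
  "scheme_cond AxT \<Lambda> W R \<longleftrightarrow>
    (\<forall>v\<in>W. \<forall>\<beta>\<in>\<Lambda>. (v \<beta> \<in> Nset \<longrightarrow> v \<beta> \<in> Des) \<and> (v \<beta> \<in> Iset \<longrightarrow> v \<beta> \<notin> Des))"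
| "scheme_cond AxD \<Lambda> W R \<longleftrightarrow>
    (\<forall>v\<in>W. \<forall>\<beta>\<in>\<Lambda>. (v \<beta> \<in> Nset \<longrightarrow> v \<beta> \<in> Pset) \<and> (v \<beta> \<in> Iset \<longrightarrow> v \<beta> \<in> PNset))"
| "scheme_cond AxB \<Lambda> W R \<longleftrightarrow>
    (\<forall>v\<in>W. \<forall>w\<in>W. \<forall>\<beta>\<in>\<Lambda>. (v, w) \<in> R \<longrightarrow>
      (v \<beta> \<in> Des \<longrightarrow> w \<beta> \<in> Pset) \<and> (v \<beta> \<notin> Des \<longrightarrow> w \<beta> \<in> PNset))"
| "scheme_cond Ax4 \<Lambda> W R \<longleftrightarrow>
    (\<forall>v\<in>W. \<forall>w\<in>W. \<forall>\<beta>\<in>\<Lambda>. (v, w) \<in> R \<longrightarrow>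
      (v \<beta> \<in> Nset \<longrightarrow> w \<beta> \<in> Nset) \<and> (v \<beta> \<in> Iset \<longrightarrow> w \<beta> \<in> Iset))"
| "scheme_cond Ax5 \<Lambda> W R \<longleftrightarrow>
    (\<forall>v\<in>W. \<forall>w\<in>W. \<forall>\<beta>\<in>\<Lambda>. (v, w) \<in> R \<longrightarrow>
      (v \<beta> \<in> Pset \<longrightarrow> w \<beta> \<in> Pset) \<and> (v \<beta> \<in> PNset \<longrightarrow> w \<beta> \<in> PNset)) \<and>
    (\<forall>v\<in>W. \<forall>w\<in>W. \<forall>w'\<in>W. \<forall>\<beta>\<in>\<Lambda>. (v, w) \<in> R \<and> ((v, w') \<in> R \<or> (w, w') \<in> R) \<longrightarrow>
      (v \<beta> \<in> Nset \<and> w \<beta> \<in> Nset \<longrightarrow> w' \<beta> \<in> Nset) \<and>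
      (v \<beta> \<in> Iset \<and> w \<beta> \<in> Iset \<longrightarrow> w' \<beta> \<in> Iset))"

text \<open>
  A scheme holds in a logic when all its instances are derivable, whether or not it is one of
  the axioms.
\<close>

definition L_model ::
  "modal_logic \<Rightarrow> 'p fm set \<Rightarrow> ('p fm \<Rightarrow> tval) set \<Rightarrow> ('p fm \<Rightarrow> tval) rel \<Rightarrow> bool" where
  "L_model L \<Lambda> W R \<longleftrightarrow>
    K_model L \<Lambda> W R \<and>
    (\<forall>S. instances S \<subseteq> (theorems L :: 'p fm set) \<longrightarrow> scheme_cond S \<Lambda> W R)"

definition partial_level_valuation ::
  "modal_logic \<Rightarrow> 'p fm set \<Rightarrow> ('p fm \<Rightarrow> tval) \<Rightarrow> bool" where
  "partial_level_valuation L \<Lambda> v \<longleftrightarrow> (\<exists>W R. L_model L \<Lambda> W R \<and> v \<in> W)"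

end

theory Submission
  imports Defs
begin

text \<open>
  A truth value is a triple of bits: is the formula true here, is it true in all successors, is it
  false in all successors. A level-valuation designates a maximal consistent set, and it is the
  valuation read off from this set in the canonical Kripke model. The canonical model generated by
  this set, with every world restricted to \<^term>\<open>\<Lambda>\<close>, is the required model. Restriction may
  identify worlds, which is harmless for the conditions about pairs of related worlds. The
  three-world condition of (5) survives because in a generated Euclidean frame all
  worlds having a predecessor have the same successors.
\<close>

section \<open>Maximal consistent sets\<close>

text \<open>Closure under necessitation is not demanded: these sets are closed under local
  consequence, as the set of formulas true at one world is.\<close>

definition deductively_closed :: "modal_logic \<Rightarrow> 'p fm set \<Rightarrow> bool" where
  "deductively_closed L \<Gamma> \<longleftrightarrow>
    theorems L \<subseteq> \<Gamma> \<and> (\<forall>\<alpha> \<beta>. (\<alpha> \<^bold>\<rightarrow> \<beta>) \<in> \<Gamma> \<longrightarrow> \<alpha> \<in> \<Gamma> \<longrightarrow> \<beta> \<in> \<Gamma>)"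

text \<open>Maximality is encoded as the truth condition of implication. For
  \<open>\<beta> = Bot\<close> it puts exactly one of \<alpha> and \<open>Neg \<alpha>\<close> into
  the set.\<close>

definition mcs :: "modal_logic \<Rightarrow> 'p fm set \<Rightarrow> bool" where
  "mcs L \<Gamma> \<longleftrightarrow>
    theorems L \<subseteq> \<Gamma> \<and> Bot \<notin> \<Gamma> \<and> (\<forall>\<alpha> \<beta>. (\<alpha> \<^bold>\<rightarrow> \<beta>) \<in> \<Gamma> \<longleftrightarrow> (\<alpha> \<in> \<Gamma> \<longrightarrow> \<beta> \<in> \<Gamma>))"

section \<open>Propositional reasoning in deductively closed sets\<close>

lemma deductively_closed_mp:
  "\<lbrakk>deductively_closed L \<Gamma>; (\<alpha> \<^bold>\<rightarrow> \<beta>) \<in> \<Gamma>; \<alpha> \<in> \<Gamma>\<rbrakk> \<Longrightarrow> \<beta> \<in> \<Gamma>"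
  by (auto simp: deductively_closed_def)

lemma deductively_closed_theorem:
  "\<lbrakk>deductively_closed L \<Gamma>; \<alpha> \<in> theorems L\<rbrakk> \<Longrightarrow> \<alpha> \<in> \<Gamma>"
  by (auto simp: deductively_closed_def)

lemma theorems_refl: "\<alpha> \<^bold>\<rightarrow> \<alpha> \<in> theorems L"
  by (rule mp[OF mp[OF ax_distr[of \<alpha> "\<alpha> \<^bold>\<rightarrow> \<alpha>" \<alpha>]]]) (rule ax_weaken)+

lemma deductively_closed_weaken:
  assumes "deductively_closed L \<Gamma>" "\<beta> \<in> \<Gamma>"
  shows "(\<alpha> \<^bold>\<rightarrow> \<beta>) \<in> \<Gamma>"
  using deductively_closed_mp[OF assms(1) deductively_closed_theorem[OF assms(1) ax_weaken] assms(2)] .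

text \<open>The set is the deductive closure of \<Gamma> with \<phi> adjoined, so reasoning inside
  it takes the place of the deduction theorem.\<close>

lemma deductively_closed_extend:
  assumes \<Gamma>: "deductively_closed L \<Gamma>"
  shows "deductively_closed L {\<gamma>. (\<phi> \<^bold>\<rightarrow> \<gamma>) \<in> \<Gamma>}"
  unfolding deductively_closed_def[of L "{\<gamma>. (\<phi> \<^bold>\<rightarrow> \<gamma>) \<in> \<Gamma>}"]
  by (blast intro: deductively_closed_weaken[OF \<Gamma>] deductively_closed_theorem[OF \<Gamma>]
      deductively_closed_mp[OF \<Gamma>] ax_distr)

lemma deductively_closed_trans:
  assumes \<Gamma>: "deductively_closed L \<Gamma>" and "(\<alpha> \<^bold>\<rightarrow> \<beta>) \<in> \<Gamma>" "(\<beta> \<^bold>\<rightarrow> \<gamma>) \<in> \<Gamma>"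
  shows "(\<alpha> \<^bold>\<rightarrow> \<gamma>) \<in> \<Gamma>"
  using deductively_closed_mp[OF deductively_closed_extend[OF \<Gamma>, of \<alpha>], of \<beta> \<gamma>]
    deductively_closed_weaken[OF \<Gamma>] assms by blast

lemma deductively_closed_efq:
  assumes \<Gamma>: "deductively_closed L \<Gamma>"
  shows "(Bot \<^bold>\<rightarrow> \<alpha>) \<in> \<Gamma>"
proof (rule deductively_closed_trans[OF \<Gamma>])
  show "(Bot \<^bold>\<rightarrow> Neg (Neg \<alpha>)) \<in> \<Gamma>"
    unfolding Neg_def[of "Neg \<alpha>"] by (rule deductively_closed_theorem[OF \<Gamma> ax_weaken])
  show "(Neg (Neg \<alpha>) \<^bold>\<rightarrow> \<alpha>) \<in> \<Gamma>"
    by (rule deductively_closed_theorem[OF \<Gamma> ax_dneg])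
qed

text \<open>Classical case distinction on \<alpha>. Under \<open>Neg \<gamma>\<close> the first
  premise refutes \<alpha>, so \<alpha> implies \<beta> and the second premise returns \<gamma>.
  This contradiction yields \<open>Neg (Neg \<gamma>)\<close>.\<close>

lemma deductively_closed_cases:
  assumes \<Gamma>: "deductively_closed L \<Gamma>" and 1: "(\<alpha> \<^bold>\<rightarrow> \<gamma>) \<in> \<Gamma>" and 2: "((\<alpha> \<^bold>\<rightarrow> \<beta>) \<^bold>\<rightarrow> \<gamma>) \<in> \<Gamma>"
  shows "\<gamma> \<in> \<Gamma>"
proof -
  let ?\<Gamma> = "{\<delta>. (Neg \<gamma> \<^bold>\<rightarrow> \<delta>) \<in> \<Gamma>}"
  note \<Gamma>' = deductively_closed_extend[OF \<Gamma>, of "Neg \<gamma>"]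
  have neg: "(\<gamma> \<^bold>\<rightarrow> Bot) \<in> ?\<Gamma>"
    using deductively_closed_theorem[OF \<Gamma> theorems_refl] by (simp add: Neg_def)
  have "(\<alpha> \<^bold>\<rightarrow> \<gamma>) \<in> ?\<Gamma>" "((\<alpha> \<^bold>\<rightarrow> \<beta>) \<^bold>\<rightarrow> \<gamma>) \<in> ?\<Gamma>"
    using deductively_closed_weaken[OF \<Gamma>] 1 2 by auto
  then have "Bot \<in> ?\<Gamma>"
    using deductively_closed_trans[OF \<Gamma>'] deductively_closed_efq[OF \<Gamma>'] neg
      deductively_closed_mp[OF \<Gamma>'] by metis
  then have "Neg (Neg \<gamma>) \<in> \<Gamma>"
    by (simp add: Neg_def)
  then show ?thesis
    using deductively_closed_mp[OF \<Gamma>] deductively_closed_theorem[OF \<Gamma> ax_dneg] by blast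
qed

text \<open>Zorn's lemma gives a set that is maximal among the deductively closed sets containing
  \<Gamma> and omitting \<phi>. Omitting \<phi> ensures consistency, since a closed set with
  \<open>Bot\<close> contains every formula.\<close>

lemma Lindenbaum:
  assumes \<Gamma>: "deductively_closed L \<Gamma>" and "\<phi> \<notin> \<Gamma>"
  obtains \<Delta> where "mcs L \<Delta>" "\<Gamma> \<subseteq> \<Delta>" "\<phi> \<notin> \<Delta>"
proof -
  let ?A = "{\<Delta>. deductively_closed L \<Delta> \<and> \<Gamma> \<subseteq> \<Delta> \<and> \<phi> \<notin> \<Delta>}"
  have "\<exists>M\<in>?A. \<forall>X\<in>?A. M \<subseteq> X \<longrightarrow> X = M"
  proof (rule subset_Zorn_nonempty)
    show "?A \<noteq> {}"
      using assms by blast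
    fix C assume "C \<noteq> {}" and "subset.chain ?A C"
    then have C: "\<And>\<Delta>. \<Delta> \<in> C \<Longrightarrow> \<Delta> \<in> ?A" and total: "\<And>X Y. X \<in> C \<Longrightarrow> Y \<in> C \<Longrightarrow> X \<subseteq> Y \<or> Y \<subseteq> X"
      by (auto simp: subset.chain_def)
    have "\<beta> \<in> \<Union>C" if in_union: "(\<alpha> \<^bold>\<rightarrow> \<beta>) \<in> \<Union>C" "\<alpha> \<in> \<Union>C" for \<alpha> \<beta>
    proof -
      obtain X where "X \<in> C" "(\<alpha> \<^bold>\<rightarrow> \<beta>) \<in> X" "\<alpha> \<in> X"
        using in_union total by (meson UnionE subsetD)
      then show ?thesis
        using C deductively_closed_mp by blast
    qed
    then show "\<Union>C \<in> ?A"
      using C \<open>C \<noteq> {}\<close> unfolding deductively_closed_def by fast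
  qed
  then obtain \<Delta> where "\<Delta> \<in> ?A" and "\<forall>X\<in>?A. \<Delta> \<subseteq> X \<longrightarrow> X = \<Delta>"
    by (rule bexE)
  then have \<Delta>: "deductively_closed L \<Delta>" "\<Gamma> \<subseteq> \<Delta>" "\<phi> \<notin> \<Delta>"
    and max: "\<And>X. \<lbrakk>deductively_closed L X; \<Gamma> \<subseteq> X; \<phi> \<notin> X; \<Delta> \<subseteq> X\<rbrakk> \<Longrightarrow> X = \<Delta>"
    by simp_all
  \<comment> \<open>Adjoining \<alpha> gives a strictly larger closed set, which by maximality must
    contain \<phi>.\<close>
  have imp: "(\<alpha> \<^bold>\<rightarrow> \<phi>) \<in> \<Delta>" if "\<alpha> \<notin> \<Delta>" for \<alpha>
  proof (rule ccontr)
    assume "(\<alpha> \<^bold>\<rightarrow> \<phi>) \<notin> \<Delta>"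
    moreover have "\<Delta> \<subseteq> {\<gamma>. (\<alpha> \<^bold>\<rightarrow> \<gamma>) \<in> \<Delta>}"
      using deductively_closed_weaken[OF \<Delta>(1)] by blast
    ultimately have "{\<gamma>. (\<alpha> \<^bold>\<rightarrow> \<gamma>) \<in> \<Delta>} = \<Delta>"
      using max deductively_closed_extend[OF \<Delta>(1)] \<Delta>(2) by blast
    moreover have "(\<alpha> \<^bold>\<rightarrow> \<alpha>) \<in> \<Delta>"
      by (rule deductively_closed_theorem[OF \<Delta>(1) theorems_refl])
    ultimately show False
      using that by blast
  qed
  have "mcs L \<Delta>"
    unfolding mcs_def
  proof (intro conjI allI iffI impI)
    show "theorems L \<subseteq> \<Delta>"
      using \<Delta>(1) by (simp add: deductively_closed_def)
    show "Bot \<notin> \<Delta>"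
      using deductively_closed_mp[OF \<Delta>(1) deductively_closed_efq[OF \<Delta>(1)]] \<Delta>(3) by blast
    show "\<beta> \<in> \<Delta>" if "(\<alpha> \<^bold>\<rightarrow> \<beta>) \<in> \<Delta>" "\<alpha> \<in> \<Delta>" for \<alpha> \<beta>
      using that deductively_closed_mp[OF \<Delta>(1)] by blast
    \<comment> \<open>The critical case is \<open>\<alpha> \<notin> \<Delta>\<close>: if the
      implication were missing too, both would imply \<phi>, and the case distinction would put
      \<phi> into \<Delta>.\<close>
    show "(\<alpha> \<^bold>\<rightarrow> \<beta>) \<in> \<Delta>" if "\<alpha> \<in> \<Delta> \<longrightarrow> \<beta> \<in> \<Delta>" for \<alpha> \<beta>
      using that deductively_closed_weaken[OF \<Delta>(1)] imp
        deductively_closed_cases[OF \<Delta>(1), of \<alpha> \<phi> \<beta>] \<Delta>(3) by blast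
  qed
  then show thesis
    using that \<Delta> by blast
qed

lemma mcs_imp: "mcs L \<Gamma> \<Longrightarrow> (\<alpha> \<^bold>\<rightarrow> \<beta>) \<in> \<Gamma> \<longleftrightarrow> (\<alpha> \<in> \<Gamma> \<longrightarrow> \<beta> \<in> \<Gamma>)"
  by (simp add: mcs_def)

lemma mcs_Neg: "mcs L \<Gamma> \<Longrightarrow> Neg \<alpha> \<in> \<Gamma> \<longleftrightarrow> \<alpha> \<notin> \<Gamma>"
  by (simp add: mcs_def Neg_def)

lemma mcs_Dia: "mcs L \<Gamma> \<Longrightarrow> Dia \<alpha> \<in> \<Gamma> \<longleftrightarrow> Box (Neg \<alpha>) \<notin> \<Gamma>"
  by (simp add: mcs_Neg Dia_def)

lemma mcs_theorem: "mcs L \<Gamma> \<Longrightarrow> \<alpha> \<in> theorems L \<Longrightarrow> \<alpha> \<in> \<Gamma>"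
  by (auto simp: mcs_def)

section \<open>The canonical frame\<close>

text \<open>Maximal consistency is part of the relation, so all members of
  \<open>sucs L \<Gamma>\<close> are maximal consistent.\<close>

definition canonical :: "modal_logic \<Rightarrow> 'p fm set rel" where
  "canonical L = {(\<Gamma>, \<Delta>). mcs L \<Gamma> \<and> mcs L \<Delta> \<and> {\<beta>. Box \<beta> \<in> \<Gamma>} \<subseteq> \<Delta>}"

abbreviation sucs :: "modal_logic \<Rightarrow> 'p fm set \<Rightarrow> 'p fm set set" where
  "sucs L \<Gamma> \<equiv> canonical L `` {\<Gamma>}"

text \<open>For the converse direction, necessitation and axiom (k) make the formulas necessary at
  \<Gamma> a deductively closed set. If it omits \<alpha>, Lindenbaum extends it to a successor that
  omits \<alpha>.\<close>

lemma mcs_Box: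
  assumes \<Gamma>: "mcs L \<Gamma>"
  shows "Box \<alpha> \<in> \<Gamma> \<longleftrightarrow> (\<forall>\<Delta>\<in>sucs L \<Gamma>. \<alpha> \<in> \<Delta>)"
proof
  assume "Box \<alpha> \<in> \<Gamma>"
  then show "\<forall>\<Delta>\<in>sucs L \<Gamma>. \<alpha> \<in> \<Delta>"
    by (auto simp: canonical_def)
next
  have closed: "deductively_closed L {\<beta>. Box \<beta> \<in> \<Gamma>}"
    using \<Gamma> ax_k nec unfolding deductively_closed_def mcs_def by blast
  assume all: "\<forall>\<Delta>\<in>sucs L \<Gamma>. \<alpha> \<in> \<Delta>"
  show "Box \<alpha> \<in> \<Gamma>"
  proof (rule ccontr)
    assume "Box \<alpha> \<notin> \<Gamma>"
    then obtain \<Delta> where "mcs L \<Delta>" "{\<beta>. Box \<beta> \<in> \<Gamma>} \<subseteq> \<Delta>" "\<alpha> \<notin> \<Delta>"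
      using Lindenbaum[OF closed, of \<alpha>] by blast
    with \<Gamma> all show False
      by (simp add: canonical_def)
  qed
qed

section \<open>Frame properties given by derivable schemes\<close>

lemma canonical_serial:
  assumes "instances AxD \<subseteq> (theorems L :: 'p fm set)" "mcs L (\<Gamma> :: 'p fm set)"
  shows "sucs L \<Gamma> \<noteq> {}"
proof
  assume "sucs L \<Gamma> = {}"
  moreover have "(Box Bot \<^bold>\<rightarrow> Dia Bot) \<in> \<Gamma>"
    using assms(1) by (intro mcs_theorem[OF assms(2)]) auto
  ultimately show False
    using assms(2) by (simp add: mcs_imp mcs_Dia mcs_Box)
qed

lemma canonical_refl:
  assumes "instances AxT \<subseteq> (theorems L :: 'p fm set)" "mcs L (\<Gamma> :: 'p fm set)"
  shows "(\<Gamma>, \<Gamma>) \<in> canonical L"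
proof -
  have "(Box \<alpha> \<^bold>\<rightarrow> \<alpha>) \<in> \<Gamma>" for \<alpha>
    using assms(1) by (intro mcs_theorem[OF assms(2)]) auto
  then show ?thesis
    using assms(2) by (auto simp: canonical_def mcs_imp)
qed

text \<open>If \<alpha> is necessary at \<Delta> but false at \<Gamma>, then (B) for
  \<open>Neg \<alpha>\<close> makes \<open>Dia (Neg \<alpha>)\<close> true at \<Delta>, a
  contradiction.\<close>

lemma canonical_sym:
  assumes "instances AxB \<subseteq> (theorems L :: 'p fm set)"
    and "(\<Gamma>, \<Delta> :: 'p fm set) \<in> canonical L"
  shows "(\<Delta>, \<Gamma>) \<in> canonical L"
proof -
  have m: "mcs L \<Gamma>" "mcs L \<Delta>" and sub: "\<And>\<alpha>. Box \<alpha> \<in> \<Gamma> \<Longrightarrow> \<alpha> \<in> \<Delta>"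
    using assms(2) by (auto simp: canonical_def)
  have "\<alpha> \<in> \<Gamma>" if "Box \<alpha> \<in> \<Delta>" for \<alpha>
  proof (rule ccontr)
    assume "\<alpha> \<notin> \<Gamma>"
    moreover have "(Neg \<alpha> \<^bold>\<rightarrow> Box (Dia (Neg \<alpha>))) \<in> \<Gamma>"
      using assms(1) by (intro mcs_theorem[OF m(1)]) auto
    ultimately have "Dia (Neg \<alpha>) \<in> \<Delta>"
      using m sub by (simp add: mcs_imp mcs_Neg)
    then have "Box (Neg (Neg \<alpha>)) \<notin> \<Delta>"
      using m by (simp add: mcs_Dia)
    \<comment> \<open>\<open>Dia (Neg \<alpha>)\<close> has a double negation under its box; it is
      introduced here at each successor of \<Delta> by \<open>mcs_Box\<close>.\<close>
    moreover have "Box (Neg (Neg \<alpha>)) \<in> \<Delta>"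
      using that m by (auto simp: mcs_Box canonical_def mcs_Neg)
    ultimately show False ..
  qed
  then show ?thesis
    using m by (auto simp: canonical_def)
qed

lemma canonical_trans:
  assumes "instances Ax4 \<subseteq> (theorems L :: 'p fm set)"
    and "(\<Gamma>, \<Delta> :: 'p fm set) \<in> canonical L" "(\<Delta>, \<Theta>) \<in> canonical L"
  shows "(\<Gamma>, \<Theta>) \<in> canonical L"
proof -
  have m: "mcs L \<Gamma>"
    using assms(2) by (auto simp: canonical_def)
  have "(Box \<alpha> \<^bold>\<rightarrow> Box (Box \<alpha>)) \<in> \<Gamma>" for \<alpha>
    using assms(1) by (intro mcs_theorem[OF m]) auto
  then show ?thesis
    using assms(2,3) m unfolding canonical_def by (auto simp: mcs_imp)
qed

text \<open>As for symmetry, but \<open>Dia (Neg \<alpha>)\<close> is true at \<Gamma> because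
  \<alpha> fails at \<Theta>, and (5) carries it over to \<Delta>.\<close>

lemma canonical_euclidean:
  assumes "instances Ax5 \<subseteq> (theorems L :: 'p fm set)"
    and "(\<Gamma>, \<Delta> :: 'p fm set) \<in> canonical L" "(\<Gamma>, \<Theta>) \<in> canonical L"
  shows "(\<Delta>, \<Theta>) \<in> canonical L"
proof -
  have m: "mcs L \<Gamma>" "mcs L \<Delta>" "mcs L \<Theta>" and sub: "\<And>\<alpha>. Box \<alpha> \<in> \<Gamma> \<Longrightarrow> \<alpha> \<in> \<Delta>"
    using assms(2,3) by (auto simp: canonical_def)
  have "\<alpha> \<in> \<Theta>" if "Box \<alpha> \<in> \<Delta>" for \<alpha>
  proof (rule ccontr)
    assume "\<alpha> \<notin> \<Theta>"
    then have "Dia (Neg \<alpha>) \<in> \<Gamma>"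
      using m assms(3) by (auto simp: mcs_Dia mcs_Box mcs_Neg intro!: bexI[of _ \<Theta>])
    moreover have "(Dia (Neg \<alpha>) \<^bold>\<rightarrow> Box (Dia (Neg \<alpha>))) \<in> \<Gamma>"
      using assms(1) by (intro mcs_theorem[OF m(1)]) auto
    ultimately have "Dia (Neg \<alpha>) \<in> \<Delta>"
      using m sub by (simp add: mcs_imp)
    then have "Box (Neg (Neg \<alpha>)) \<notin> \<Delta>"
      using m by (simp add: mcs_Dia)
    moreover have "Box (Neg (Neg \<alpha>)) \<in> \<Delta>"
      using that m by (auto simp: mcs_Box canonical_def mcs_Neg)
    ultimately show False ..
  qed
  then show ?thesis
    using m by (auto simp: canonical_def)
qed

text \<open>Two successors of one world see each other and hence have the same successors. Induction
  carries this from the successors of \<open>r\<close> to all worlds reachable in at least one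
  step.\<close>

lemma euclidean_sucs_eq:
  assumes euclid: "\<And>x y z. \<lbrakk>(x, y) \<in> R; (x, z) \<in> R\<rbrakk> \<Longrightarrow> (y, z) \<in> R"
    and "(r, s) \<in> R" "(r, x) \<in> R\<^sup>+"
  shows "R `` {x} = R `` {s}"
  using assms(3)
proof (induction rule: trancl_induct)
  case (base y)
  then show ?case
    using euclid assms(2) by blast
next
  case (step y z)
  \<comment> \<open>Having a predecessor, \<open>y\<close> sees itself, so \<open>y\<close> and
    \<open>z\<close> are both successors of \<open>y\<close>.\<close>
  then obtain u where "(u, y) \<in> R"
    by (meson tranclE)
  then have "R `` {z} = R `` {y}"
    using euclid step(2) by blast
  with step.IH show ?case
    by simp
qed

section \<open>Truth values in the canonical model\<close>

text \<open>The bits stand for truth here, truth in all successors and falsity in all successors.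
  \<open>Vf2\<close> and \<open>Vt2\<close>, where \<open>n\<close> and \<open>i\<close> both hold,
  are the values at worlds without successors.\<close>

definition tval_of :: "bool \<Rightarrow> bool \<Rightarrow> bool \<Rightarrow> tval" where
  "tval_of d n i =
    (if d then if n then if i then Vt2 else VT else if i then Vt3 else Vt
     else if n then if i then Vf2 else Vf3 else if i then VF else Vf)"

definition canonical_val :: "modal_logic \<Rightarrow> 'p fm set \<Rightarrow> 'p fm \<Rightarrow> tval" where
  "canonical_val L \<Gamma> \<alpha> =
    tval_of (\<alpha> \<in> \<Gamma>) (\<forall>\<Delta>\<in>sucs L \<Gamma>. \<alpha> \<in> \<Delta>) (\<forall>\<Delta>\<in>sucs L \<Gamma>. \<alpha> \<notin> \<Delta>)"

lemmas tval_set_defs = Des_def Nset_def Iset_def Pset_def PNset_def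

text \<open>A value is determined by its membership in three sets, so values can be compared bit by
  bit.\<close>

lemma tval_of_bits: "tval_of (x \<in> Des) (x \<in> Nset) (x \<in> Iset) = x"
  by (cases x) (simp_all add: tval_of_def tval_set_defs)

lemma tval_of_mem:
  "tval_of d n i \<in> Des \<longleftrightarrow> d"
  "tval_of d n i \<in> Nset \<longleftrightarrow> n"
  "tval_of d n i \<in> Iset \<longleftrightarrow> i"
  "tval_of d n i \<in> Pset \<longleftrightarrow> \<not> i"
  "tval_of d n i \<in> PNset \<longleftrightarrow> \<not> n"
  by (simp_all add: tval_of_def tval_set_defs)

lemma canonical_val_mem:
  "canonical_val L \<Gamma> \<alpha> \<in> Des \<longleftrightarrow> \<alpha> \<in> \<Gamma>"
  "canonical_val L \<Gamma> \<alpha> \<in> Nset \<longleftrightarrow> (\<forall>\<Delta>\<in>sucs L \<Gamma>. \<alpha> \<in> \<Delta>)"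
  "canonical_val L \<Gamma> \<alpha> \<in> Iset \<longleftrightarrow> (\<forall>\<Delta>\<in>sucs L \<Gamma>. \<alpha> \<notin> \<Delta>)"
  "canonical_val L \<Gamma> \<alpha> \<in> Pset \<longleftrightarrow> (\<exists>\<Delta>\<in>sucs L \<Gamma>. \<alpha> \<in> \<Delta>)"
  "canonical_val L \<Gamma> \<alpha> \<in> PNset \<longleftrightarrow> (\<exists>\<Delta>\<in>sucs L \<Gamma>. \<alpha> \<notin> \<Delta>)"
  by (simp_all add: canonical_val_def tval_of_mem)

text \<open>The implication table is sound for Kripke semantics: \<open>S\<close> is the set of
  successors, \<open>D\<close> and \<open>E\<close> the truth of premise and conclusion
  there.\<close>

lemma tval_of_imp:
  "tval_of (d \<longrightarrow> e) (\<forall>x\<in>S. D x \<longrightarrow> E x) (\<forall>x\<in>S. \<not> (D x \<longrightarrow> E x))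
    \<in> imp_tt (tval_of d (\<forall>x\<in>S. D x) (\<forall>x\<in>S. \<not> D x)) (tval_of e (\<forall>x\<in>S. E x) (\<forall>x\<in>S. \<not> E x))"
proof (cases "S = {}")
  case True
  then show ?thesis
    by (cases d; cases e) (simp_all add: tval_of_def)
next
  case False
  define n1 i1 n2 i2 n3 i3 where defs: "n1 = (\<forall>x\<in>S. D x)" "i1 = (\<forall>x\<in>S. \<not> D x)"
    "n2 = (\<forall>x\<in>S. E x)" "i2 = (\<forall>x\<in>S. \<not> E x)"
    "n3 = (\<forall>x\<in>S. D x \<longrightarrow> E x)" "i3 = (\<forall>x\<in>S. \<not> (D x \<longrightarrow> E x))"
  \<comment> \<open>These relations leave \<open>n3\<close> open only if \<open>n1\<close>,
    \<open>i1\<close>, \<open>n2\<close> and \<open>i2\<close> are all false, which is where the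
    table has two-element entries.\<close>
  have "\<not> (n1 \<and> i1)" "\<not> (n2 \<and> i2)" "i3 = (n1 \<and> i2)" "n1 \<longrightarrow> n3 = n2" "i2 \<longrightarrow> n3 = i1"
    "i1 \<longrightarrow> n3" "n2 \<longrightarrow> n3"
    using False unfolding defs by blast+
  then have "tval_of (d \<longrightarrow> e) n3 i3 \<in> imp_tt (tval_of d n1 i1) (tval_of e n2 i2)"
    by (cases d; cases e; cases n1; cases i1; cases n2; cases i2) (simp_all add: tval_of_def)
  then show ?thesis
    unfolding defs .
qed

section \<open>Canonical values obey the range of values and the box table\<close>

lemma theorem_instances: "S \<in> schemes L \<Longrightarrow> instances S \<subseteq> theorems L"
  by (blast intro: ax_scheme)

text \<open>Seriality excludes \<open>Vf2\<close> and \<open>Vt2\<close>; reflexivity also excludes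
  \<open>Vf3\<close> and \<open>Vt3\<close>.\<close>

lemma canonical_val_in_vals:
  assumes m: "mcs L (\<Gamma> :: 'p fm set)"
  shows "canonical_val L \<Gamma> \<alpha> \<in> vals L"
proof -
  let ?v = "canonical_val L \<Gamma> \<alpha>"
  have serial: "?v \<in> {VF, Vf, Vf3, Vt3, Vt, VT}" if "sucs L \<Gamma> \<noteq> {}"
    using that by (auto simp: canonical_val_def tval_of_def)
  have refl: "?v \<in> {VF, Vf, Vt, VT}" if "(\<Gamma>, \<Gamma>) \<in> canonical L"
    using that by (auto simp: canonical_val_def tval_of_def)
  consider "L \<in> {K, KB, K4, K5, K45}" | "L = KB5" | "AxD \<in> schemes L" "AxT \<notin> schemes L" | "AxT \<in> schemes L"
    by (cases L) auto
  then show ?thesis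
  proof cases
    case 1
    then show ?thesis
      by (auto simp: canonical_val_def tval_of_def vals_def)
  next
    case 2
    then have "AxB \<in> schemes L" "Ax4 \<in> schemes L"
      by auto
    note axioms = this[THEN theorem_instances]
    \<comment> \<open>In a symmetric and transitive frame a world with a successor sees itself, so
      it has one of the four reflexive values; otherwise it has \<open>Vf2\<close> or
      \<open>Vt2\<close>.\<close>
    have "(\<Gamma>, \<Gamma>) \<in> canonical L" if "sucs L \<Gamma> \<noteq> {}"
      using that canonical_sym[OF axioms(1)] canonical_trans[OF axioms(2)] by blast
    then show ?thesis
      using refl 2 by (cases "sucs L \<Gamma> = {}") (auto simp: canonical_val_def tval_of_def vals_def)
  next
    case 3
    then show ?thesis
      using serial[OF canonical_serial[OF theorem_instances m]] by (cases L) (auto simp: vals_def)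
  next
    case 4
    then show ?thesis
      using refl[OF canonical_refl[OF theorem_instances m]] by (cases L) (auto simp: vals_def)
  qed
qed

text \<open>Reduces the box tables to propositional logic. The bits of \<alpha> are
  \<open>d\<close>, \<open>n\<close>, \<open>i\<close>; those of \<open>Box \<alpha>\<close> are
  \<open>n\<close>, \<open>n'\<close>, \<open>i'\<close>. Both \<open>n \<and> i\<close> and
  \<open>n' \<and> i'\<close> say that there are no successors, and each further conjunct but the
  last expresses a frame property. In this form the claim is settled by enumerating logics and
  bits.\<close>

lemma tval_of_box:
  "(n \<and> i \<longleftrightarrow> n' \<and> i') \<and>
   (AxD \<in> schemes L \<longrightarrow> \<not> (n \<and> i)) \<and>
   (AxT \<in> schemes L \<longrightarrow> (n \<longrightarrow> d) \<and> (i \<longrightarrow> \<not> d) \<and> (n' \<longrightarrow> n) \<and> (i' \<longrightarrow> \<not> n) \<and> (i \<longrightarrow> i')) \<and>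
   (AxB \<in> schemes L \<longrightarrow> (\<not> d \<longrightarrow> i') \<and> (n' \<and> \<not> d \<longrightarrow> n \<and> i)) \<and>
   (Ax4 \<in> schemes L \<longrightarrow> n \<longrightarrow> n') \<and>
   (Ax5 \<in> schemes L \<longrightarrow> (\<not> n \<longrightarrow> i') \<and> (n \<longrightarrow> n' \<or> i')) \<and>
   (AxD \<in> schemes L \<and> Ax4 \<in> schemes L \<longrightarrow> i \<longrightarrow> i') \<and>
   tval_of d n i \<in> vals L
   \<longrightarrow> tval_of n n' i' \<in> box_tt L (tval_of d n i)"
  by (induct L; induct d; induct n; induct i; induct n'; induct i')
    (simp_all add: tval_of_def vals_def)
text \<open>The bits of \<open>Box \<alpha>\<close> are expressed by \<alpha> at worlds one and two
  steps away. The frame properties of the schemes then supply the premises of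
  \<open>tval_of_box\<close>.\<close>

lemma canonical_val_Box:
  assumes m: "mcs L (\<Gamma> :: 'p fm set)"
  shows "canonical_val L \<Gamma> (Box \<alpha>) \<in> box_tt L (canonical_val L \<Gamma> \<alpha>)"
proof -
  have box: "canonical_val L \<Gamma> (Box \<alpha>) = tval_of (\<forall>\<Delta>\<in>sucs L \<Gamma>. \<alpha> \<in> \<Delta>)
      (\<forall>\<Delta>\<in>sucs L \<Gamma>. \<forall>\<Theta>\<in>sucs L \<Delta>. \<alpha> \<in> \<Theta>) (\<forall>\<Delta>\<in>sucs L \<Gamma>. \<exists>\<Theta>\<in>sucs L \<Delta>. \<alpha> \<notin> \<Theta>)"
  proof -
    have "Box \<alpha> \<in> \<Delta> \<longleftrightarrow> (\<forall>\<Theta>\<in>sucs L \<Delta>. \<alpha> \<in> \<Theta>)" if "\<Delta> \<in> sucs L \<Gamma>" for \<Delta>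
      using that by (intro mcs_Box) (simp add: canonical_def)
    then have "(\<forall>\<Delta>\<in>sucs L \<Gamma>. Box \<alpha> \<in> \<Delta>) \<longleftrightarrow> (\<forall>\<Delta>\<in>sucs L \<Gamma>. \<forall>\<Theta>\<in>sucs L \<Delta>. \<alpha> \<in> \<Theta>)"
      "(\<forall>\<Delta>\<in>sucs L \<Gamma>. Box \<alpha> \<notin> \<Delta>) \<longleftrightarrow> (\<forall>\<Delta>\<in>sucs L \<Gamma>. \<exists>\<Theta>\<in>sucs L \<Delta>. \<alpha> \<notin> \<Theta>)"
      by blast+
    then show ?thesis
      by (simp only: canonical_val_def mcs_Box[OF m])
  qed
  define d n i n' i' where defs:
    "d = (\<alpha> \<in> \<Gamma>)" "n = (\<forall>\<Delta>\<in>sucs L \<Gamma>. \<alpha> \<in> \<Delta>)" "i = (\<forall>\<Delta>\<in>sucs L \<Gamma>. \<alpha> \<notin> \<Delta>)"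
    "n' = (\<forall>\<Delta>\<in>sucs L \<Gamma>. \<forall>\<Theta>\<in>sucs L \<Delta>. \<alpha> \<in> \<Theta>)" "i' = (\<forall>\<Delta>\<in>sucs L \<Gamma>. \<exists>\<Theta>\<in>sucs L \<Delta>. \<alpha> \<notin> \<Theta>)"
  have K: "n \<and> i \<longleftrightarrow> n' \<and> i'"
    unfolding defs by blast+
  have D: "\<not> (n \<and> i) \<and> \<not> (n' \<and> i')" if "AxD \<in> schemes L"
    using canonical_serial[OF theorem_instances[OF that] m] unfolding K[symmetric] defs by blast
  have "(\<Delta>, \<Delta>) \<in> canonical L" if "AxT \<in> schemes L" "\<Delta> \<in> insert \<Gamma> (sucs L \<Gamma>)" for \<Delta>
    using that(2) m by (intro canonical_refl[OF theorem_instances[OF that(1)]]) (auto simp: canonical_def)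
  then have T: "(n \<longrightarrow> d) \<and> (i \<longrightarrow> \<not> d) \<and> (n' \<longrightarrow> n) \<and> (i' \<longrightarrow> \<not> n) \<and> (i \<longrightarrow> i')" if "AxT \<in> schemes L"
    using that unfolding defs by blast
  \<comment> \<open>By symmetry \<Gamma> is a successor of each of its successors. If \<alpha> fails
    at \<Gamma>, then \<open>Box \<alpha>\<close> fails at all of them, so \<open>n'\<close> can
    hold only if there are none.\<close>
  have B: "(\<not> d \<longrightarrow> i') \<and> (n' \<and> \<not> d \<longrightarrow> n \<and> i)" if "AxB \<in> schemes L"
    using canonical_sym[OF theorem_instances[OF that]] unfolding defs by blast
  have 4: "n \<longrightarrow> n'" if "Ax4 \<in> schemes L"
    using canonical_trans[OF theorem_instances[OF that]] unfolding defs by blast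
  \<comment> \<open>All successors of \<Gamma> see the same worlds: a world refuting \<alpha> that
    is seen by \<Gamma> or by one successor is seen by every successor.\<close>
  have 5: "(\<not> n \<longrightarrow> i') \<and> (n \<longrightarrow> n' \<or> i')" if "Ax5 \<in> schemes L"
  proof -
    note euclid = canonical_euclidean[OF theorem_instances[OF that]]
    have i' if "\<not> n"
    proof -
      obtain \<Theta> where \<Theta>: "(\<Gamma>, \<Theta>) \<in> canonical L" "\<alpha> \<notin> \<Theta>"
        using \<open>\<not> n\<close> unfolding defs by blast
      have "(\<Delta>, \<Theta>) \<in> canonical L" if "\<Delta> \<in> sucs L \<Gamma>" for \<Delta>
        using euclid[OF _ \<Theta>(1)] that by simp
      then show ?thesis
        using \<Theta>(2) unfolding defs by blast
    qed
    moreover have i' if \<Theta>: "(\<Gamma>, \<Delta>) \<in> canonical L" "(\<Delta>, \<Theta>) \<in> canonical L" "\<alpha> \<notin> \<Theta>" for \<Delta> \<Theta>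
    proof -
      have "(\<Delta>', \<Theta>) \<in> canonical L" if "\<Delta>' \<in> sucs L \<Gamma>" for \<Delta>'
        using euclid[OF euclid[OF \<Theta>(1)] \<Theta>(2)] that by simp
      then show ?thesis
        using \<Theta>(3) unfolding defs by blast
    qed
    ultimately show ?thesis
      unfolding defs by blast
  qed
  \<comment> \<open>Each successor has a successor by (D), which by (4) is a successor of \<Gamma>,
    so \<alpha> fails there.\<close>
  have D4: "\<not> n \<and> i \<longrightarrow> i'" if "AxD \<in> schemes L" "Ax4 \<in> schemes L"
  proof (intro impI)
    assume "\<not> n \<and> i"
    have "\<exists>\<Theta>\<in>sucs L \<Delta>. \<alpha> \<notin> \<Theta>" if "\<Delta> \<in> sucs L \<Gamma>" for \<Delta>
    proof -
      have "mcs L \<Delta>"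
        using that by (simp add: canonical_def)
      then obtain \<Theta> where "(\<Delta>, \<Theta>) \<in> canonical L"
        using canonical_serial[OF theorem_instances[OF \<open>AxD \<in> schemes L\<close>]] by blast
      moreover from this have "(\<Gamma>, \<Theta>) \<in> canonical L"
        using canonical_trans[OF theorem_instances[OF \<open>Ax4 \<in> schemes L\<close>]] that by blast
      ultimately show ?thesis
        using \<open>\<not> n \<and> i\<close> unfolding defs by blast
    qed
    then show i'
      unfolding defs by blast
  qed
  have "tval_of d n i \<in> vals L"
    using canonical_val_in_vals[OF m, of \<alpha>] by (simp add: canonical_val_def defs)
  then have "tval_of n n' i' \<in> box_tt L (tval_of d n i)"
    using K D T B 4 5 D4 by (intro tval_of_box[rule_format] conjI impI) auto
  then show ?thesis
    unfolding box by (simp add: canonical_val_def defs)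
qed

section \<open>Level-valuations designate maximal consistent sets\<close>

text \<open>By the all-or-nothing condition of level 0, the value of \<open>Bot\<close> tells
  whether the valuation describes a world without successors.\<close>

lemma level_0_values:
  assumes "v \<in> level L 0"
  shows "v \<alpha> \<in> vals L"
    and "v (\<alpha> \<^bold>\<rightarrow> \<beta>) \<in> imp_tt (v \<alpha>) (v \<beta>)"
    and "v (Box \<alpha>) \<in> box_tt L (v \<alpha>)"
    and "v Bot = VF \<and> v \<alpha> \<notin> {Vf2, Vt2} \<or> v Bot = Vf2 \<and> v \<alpha> \<in> {Vf2, Vt2}"
  using assms by (auto simp: valuations_def partial_vals_def bot_tt_def)

lemma level_0_Imp_Des:
  assumes "v \<in> level L 0"
  shows "v (\<alpha> \<^bold>\<rightarrow> \<beta>) \<in> Des \<longleftrightarrow> (v \<alpha> \<in> Des \<longrightarrow> v \<beta> \<in> Des)"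
  using level_0_values(2)[OF assms, of \<alpha> \<beta>]
  by (cases "v \<alpha>"; cases "v \<beta>") (auto simp: Des_def)

text \<open>This is axiom (k), since \<open>Box\<close> is designated exactly on
  \<open>Nset\<close>.\<close>

lemma level_0_Imp_Nset:
  assumes "v \<in> level L 0" "v (\<alpha> \<^bold>\<rightarrow> \<beta>) \<in> Nset" "v \<alpha> \<in> Nset"
  shows "v \<beta> \<in> Nset"
  using level_0_values(2)[OF assms(1), of \<alpha> \<beta>] assms(2,3)
  by (cases "v \<alpha>"; cases "v \<beta>") (auto simp: Nset_def)

text \<open>Rests on the all-or-nothing condition: \<open>v Bot = Vf2\<close> with
  \<open>v \<alpha> = Vf\<close> would give the negation the value \<open>Vt2\<close>, which lies in
  \<open>Nset\<close>.\<close>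

lemma level_0_Neg_Nset:
  assumes "v \<in> level L 0"
  shows "v (Neg \<alpha>) \<in> Nset \<longleftrightarrow> v \<alpha> \<in> Iset"
  using level_0_values(2)[OF assms, of \<alpha> Bot] level_0_values(4)[OF assms, of \<alpha>]
  by (cases "v \<alpha>") (auto simp: Neg_def Nset_def Iset_def)

lemma level_0_Neg_Iset:
  assumes "v \<in> level L 0"
  shows "v (Neg \<alpha>) \<in> Iset \<longleftrightarrow> v \<alpha> \<in> Nset"
  using level_0_values(2)[OF assms, of \<alpha> Bot] level_0_values(4)[OF assms, of \<alpha>]
  by (cases "v \<alpha>") (auto simp: Neg_def Nset_def Iset_def)

lemma level_0_Bot_Des: "v \<in> level L 0 \<Longrightarrow> v Bot \<notin> Des"
  using level_0_values(4)[of v L Bot] by (auto simp: Des_def)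

lemma level_0_Neg_Des: "v \<in> level L 0 \<Longrightarrow> v (Neg \<alpha>) \<in> Des \<longleftrightarrow> v \<alpha> \<notin> Des"
  by (simp add: Neg_def level_0_Imp_Des level_0_Bot_Des del: level.simps)

lemma level_0_Box_Des:
  assumes "v \<in> level L 0"
  shows "v (Box \<alpha>) \<in> Des \<longleftrightarrow> v \<alpha> \<in> Nset"
  using level_0_values(1,3)[OF assms, of \<alpha>]
  by (cases L; cases "v \<alpha>") (auto simp: Des_def Nset_def vals_def)

text \<open>The schemes in terms of bits. (B) and (5) will be applied to
  \<open>Neg \<alpha>\<close>, since \<open>Box (Dia \<alpha>)\<close> is designated iff the value
  of \<open>Box (Neg \<alpha>)\<close> is in \<open>Iset\<close>.\<close>

lemma level_0_schemes:
  assumes "v \<in> level L 0"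
  shows "AxD \<in> schemes L \<Longrightarrow> v \<alpha> \<in> Nset \<Longrightarrow> v \<alpha> \<notin> Iset"
    and "AxT \<in> schemes L \<Longrightarrow> v \<alpha> \<in> Nset \<Longrightarrow> v \<alpha> \<in> Des"
    and "AxB \<in> schemes L \<Longrightarrow> v \<alpha> \<notin> Des \<Longrightarrow> v (Box \<alpha>) \<in> Iset"
    and "Ax4 \<in> schemes L \<Longrightarrow> v \<alpha> \<in> Nset \<Longrightarrow> v (Box \<alpha>) \<in> Nset"
    and "Ax5 \<in> schemes L \<Longrightarrow> v \<alpha> \<notin> Nset \<Longrightarrow> v (Box \<alpha>) \<in> Iset"
  using level_0_values(1,3)[OF assms, of \<alpha>]
  by (cases L; cases "v \<alpha>"; auto simp: tval_set_defs vals_def)+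

lemma level_0_scheme_instance:
  assumes v: "v \<in> level L 0" and "S \<in> schemes L" "\<phi> \<in> instances S"
  shows "v \<phi> \<in> Des"
proof -
  note bits = level_0_Imp_Des[OF v] level_0_Neg_Des[OF v] level_0_Box_Des[OF v]
    level_0_Neg_Nset[OF v] level_0_Neg_Iset[OF v]
  show ?thesis
    using assms(2,3) level_0_schemes[OF v] bits by (cases S) (auto simp: Dia_def)
qed

section \<open>Soundness of derivations along the levels\<close>

lemma level_Suc_subset: "level L (Suc n) \<subseteq> level L n"
  by auto

lemma level_antimono: "m \<le> n \<Longrightarrow> level L n \<subseteq> level L m"
  by (rule lift_Suc_antimono_le[of "level L", OF level_Suc_subset])

text \<open>Induction on derivations: axioms are designated at level 0, modus ponens takes the
  larger of two levels, and necessitation moves up by one.\<close>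

lemma theorem_Des_at_some_level:
  "\<phi> \<in> theorems L \<Longrightarrow> \<exists>n. \<forall>v\<in>level L n. v \<phi> \<in> Des"
proof (induction rule: theorems.induct)
  case (ax_k \<alpha> \<beta>)
  show ?case
    by (intro exI[of _ 0] ballI) (simp only: level_0_Imp_Des level_0_Box_Des, blast intro: level_0_Imp_Nset)
next
  case (ax_scheme S \<alpha>)
  then show ?case
    using level_0_scheme_instance by blast
next
  case (mp \<alpha> \<beta>)
  then obtain m n where "\<forall>v\<in>level L m. v (\<alpha> \<^bold>\<rightarrow> \<beta>) \<in> Des" "\<forall>v\<in>level L n. v \<alpha> \<in> Des"
    by blast
  moreover have "level L (max m n) \<subseteq> level L m" "level L (max m n) \<subseteq> level L n"
    "level L (max m n) \<subseteq> level L 0"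
    by (rule level_antimono; simp)+
  ultimately have "\<forall>v\<in>level L (max m n). v \<beta> \<in> Des"
    using level_0_Imp_Des by blast
  then show ?case ..
next
  case (nec \<alpha>)
  then obtain n where "\<forall>v\<in>level L n. v \<alpha> \<in> Des"
    by blast
  \<comment> \<open>Passing to the next level forces the values \<open>VT\<close> or
    \<open>Vt2\<close>, both in \<open>Nset\<close>.\<close>
  then have "\<forall>v\<in>level L (Suc n). v \<alpha> \<in> Nset"
    by (auto simp: Nset_def)
  moreover have "level L (Suc n) \<subseteq> level L 0"
    by (rule level_antimono) simp
  ultimately have "\<forall>v\<in>level L (Suc n). v (Box \<alpha>) \<in> Des"
    using level_0_Box_Des by blast
  then show ?case ..
qed (intro exI[of _ 0] ballI, simp only: level_0_Imp_Des level_0_Neg_Des, blast)+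

lemma mcs_level_valuation:
  assumes "v \<in> level_valuations L"
  shows "mcs L {\<beta>. v \<beta> \<in> Des}"
proof -
  have v: "v \<in> level L n" for n
    using assms by (auto simp: level_valuations_def)
  have "theorems L \<subseteq> {\<beta>. v \<beta> \<in> Des}"
    using theorem_Des_at_some_level v by blast
  then show ?thesis
    using level_0_Imp_Des[OF v] level_0_Bot_Des[OF v] by (simp add: mcs_def)
qed

text \<open>The designated formulas determine all three bits: membership in \<open>Nset\<close> is
  designation of \<open>Box \<alpha>\<close>, and membership in \<open>Iset\<close> is membership of
  the value of \<open>Neg \<alpha>\<close> in \<open>Nset\<close>. \<open>mcs_Box\<close> turns both
  into statements about successors.\<close>

lemma level_valuation_eq_canonical_val:
  assumes "v \<in> level_valuations L"
  shows "v = canonical_val L {\<beta>. v \<beta> \<in> Des}"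
proof
  fix \<alpha>
  let ?\<Gamma> = "{\<beta>. v \<beta> \<in> Des}"
  have v: "v \<in> level L 0"
    using assms by (auto simp only: level_valuations_def)
  note m = mcs_level_valuation[OF assms]
  have nec: "v \<beta> \<in> Nset \<longleftrightarrow> (\<forall>\<Delta>\<in>sucs L ?\<Gamma>. \<beta> \<in> \<Delta>)" for \<beta>
    using mcs_Box[OF m, of \<beta>] level_0_Box_Des[OF v, of \<beta>] by simp
  have "Neg \<alpha> \<in> \<Delta> \<longleftrightarrow> \<alpha> \<notin> \<Delta>" if "\<Delta> \<in> sucs L ?\<Gamma>" for \<Delta>
    using that by (intro mcs_Neg[of L]) (simp add: canonical_def)
  then have "v \<alpha> \<in> Iset \<longleftrightarrow> (\<forall>\<Delta>\<in>sucs L ?\<Gamma>. \<alpha> \<notin> \<Delta>)"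
    using nec[of "Neg \<alpha>"] unfolding level_0_Neg_Nset[OF v] by blast
  then have "canonical_val L ?\<Gamma> \<alpha> = tval_of (v \<alpha> \<in> Des) (v \<alpha> \<in> Nset) (v \<alpha> \<in> Iset)"
    unfolding canonical_val_def nec by simp
  then show "v \<alpha> = canonical_val L ?\<Gamma> \<alpha>"
    by (simp only: tval_of_bits)
qed

section \<open>The generated canonical model\<close>

definition generated :: "modal_logic \<Rightarrow> 'p fm set \<Rightarrow> 'p fm set set" where
  "generated L \<Gamma> = (canonical L)\<^sup>* `` {\<Gamma>}"

definition restricted_val :: "modal_logic \<Rightarrow> 'p fm set \<Rightarrow> 'p fm set \<Rightarrow> 'p fm \<Rightarrow> tval" where
  "restricted_val L \<Lambda> \<Gamma> = restrict (canonical_val L \<Gamma>) \<Lambda>"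

text \<open>The image of the canonical relation: an edge holds if some pair of worlds with these
  restrictions is related, and different edges at one point may stem from different worlds.\<close>

definition restricted_rel ::
  "modal_logic \<Rightarrow> 'p fm set \<Rightarrow> 'p fm set \<Rightarrow> ('p fm \<Rightarrow> tval) rel" where
  "restricted_rel L \<Lambda> \<Gamma> =
    {(restricted_val L \<Lambda> \<Delta>, restricted_val L \<Lambda> \<Theta>) | \<Delta> \<Theta>. \<Delta> \<in> generated L \<Gamma> \<and> (\<Delta>, \<Theta>) \<in> canonical L}"

lemma restricted_val_apply: "\<beta> \<in> \<Lambda> \<Longrightarrow> restricted_val L \<Lambda> \<Gamma> \<beta> = canonical_val L \<Gamma> \<beta>"
  by (simp add: restricted_val_def)

lemma generated_step: "\<lbrakk>\<Delta> \<in> generated L \<Gamma>; (\<Delta>, \<Theta>) \<in> canonical L\<rbrakk> \<Longrightarrow> \<Theta> \<in> generated L \<Gamma>"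
  by (auto simp: generated_def intro: rtrancl_into_rtrancl)

lemma mcs_generated: "mcs L \<Gamma> \<Longrightarrow> \<Delta> \<in> generated L \<Gamma> \<Longrightarrow> mcs L \<Delta>"
  unfolding generated_def by (auto elim!: rtranclE simp: canonical_def)

text \<open>Closure under subformulas keeps arguments inside \<Lambda>, where restriction does not
  change values; the tables then hold as for canonical values.\<close>

lemma restricted_val_partial_vals:
  assumes "closed_subfms \<Lambda>" and m: "mcs L \<Gamma>"
  shows "restricted_val L \<Lambda> \<Gamma> \<in> partial_vals L \<Lambda>"
proof -
  have sub: "\<alpha> \<in> \<Lambda> \<and> \<beta> \<in> \<Lambda>" if "(\<alpha> \<^bold>\<rightarrow> \<beta>) \<in> \<Lambda>" for \<alpha> \<beta>
  proof -
    have "\<gamma> \<in> subfms \<gamma>" for \<gamma> :: "'a fm"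
      by (cases \<gamma>) auto
    then show ?thesis
      using assms(1) that unfolding closed_subfms_def by (metis UnI1 UnI2 insertI2 subfms.simps(3) subsetD)
  qed
  have sub': "\<alpha> \<in> \<Lambda>" if "Box \<alpha> \<in> \<Lambda>" for \<alpha>
  proof -
    have "\<alpha> \<in> subfms \<alpha>"
      by (cases \<alpha>) auto
    then show ?thesis
      using assms(1) that unfolding closed_subfms_def by (metis insertI2 subfms.simps(4) subsetD)
  qed
  have imp: "canonical_val L \<Gamma> (\<alpha> \<^bold>\<rightarrow> \<beta>) \<in> imp_tt (canonical_val L \<Gamma> \<alpha>) (canonical_val L \<Gamma> \<beta>)" for \<alpha> \<beta>
  proof -
    have "(\<alpha> \<^bold>\<rightarrow> \<beta>) \<in> \<Delta> \<longleftrightarrow> (\<alpha> \<in> \<Delta> \<longrightarrow> \<beta> \<in> \<Delta>)" if "\<Delta> \<in> insert \<Gamma> (sucs L \<Gamma>)" for \<Delta>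
      using that m by (intro mcs_imp) (auto simp: canonical_def)
    then have "(\<alpha> \<^bold>\<rightarrow> \<beta>) \<in> \<Gamma> \<longleftrightarrow> (\<alpha> \<in> \<Gamma> \<longrightarrow> \<beta> \<in> \<Gamma>)"
      "(\<forall>\<Delta>\<in>sucs L \<Gamma>. (\<alpha> \<^bold>\<rightarrow> \<beta>) \<in> \<Delta>) \<longleftrightarrow> (\<forall>\<Delta>\<in>sucs L \<Gamma>. \<alpha> \<in> \<Delta> \<longrightarrow> \<beta> \<in> \<Delta>)"
      "(\<forall>\<Delta>\<in>sucs L \<Gamma>. (\<alpha> \<^bold>\<rightarrow> \<beta>) \<notin> \<Delta>) \<longleftrightarrow> (\<forall>\<Delta>\<in>sucs L \<Gamma>. \<not> (\<alpha> \<in> \<Delta> \<longrightarrow> \<beta> \<in> \<Delta>))"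
      by blast+
    then show ?thesis
      by (simp only: canonical_val_def tval_of_imp)
  qed
  have bot: "canonical_val L \<Gamma> Bot \<in> bot_tt"
  proof -
    have "Bot \<notin> \<Delta>" if "\<Delta> \<in> insert \<Gamma> (sucs L \<Gamma>)" for \<Delta>
      using that m by (auto simp: canonical_def mcs_def)
    then show ?thesis
      by (auto simp: canonical_val_def bot_tt_def tval_of_def)
  qed
  show ?thesis
    unfolding partial_vals_def restricted_val_def
  proof (intro CollectI conjI allI impI)
    show "restrict (canonical_val L \<Gamma>) \<Lambda> \<in> \<Lambda> \<rightarrow>\<^sub>E vals L"
      using canonical_val_in_vals[OF m] by simp
    show "restrict (canonical_val L \<Gamma>) \<Lambda> Bot \<in> bot_tt" if "Bot \<in> \<Lambda>"
      using that bot by simp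
    show "restrict (canonical_val L \<Gamma>) \<Lambda> (\<alpha> \<^bold>\<rightarrow> \<beta>)
        \<in> imp_tt (restrict (canonical_val L \<Gamma>) \<Lambda> \<alpha>) (restrict (canonical_val L \<Gamma>) \<Lambda> \<beta>)"
      if "(\<alpha> \<^bold>\<rightarrow> \<beta>) \<in> \<Lambda>" for \<alpha> \<beta>
      using that sub[OF that] imp by simp
    show "restrict (canonical_val L \<Gamma>) \<Lambda> (Box \<alpha>) \<in> box_tt L (restrict (canonical_val L \<Gamma>) \<Lambda> \<alpha>)"
      if "Box \<alpha> \<in> \<Lambda>" for \<alpha>
      using that sub'[OF that] canonical_val_Box[OF m] by simp
  qed
qed

text \<open>Witnesses for \<open>Pset\<close> and \<open>PNset\<close> are restrictions of canonical
  successors. Conversely each edge lifts to a canonical one, along which the conditions for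
  \<open>Nset\<close> and \<open>Iset\<close> hold.\<close>

lemma K_model_restricted:
  assumes "closed_subfms \<Lambda>" "mcs L \<Gamma>"
  shows "K_model L \<Lambda> (restricted_val L \<Lambda> ` generated L \<Gamma>) (restricted_rel L \<Lambda> \<Gamma>)"
proof -
  let ?W = "restricted_val L \<Lambda> ` generated L \<Gamma>" and ?R = "restricted_rel L \<Lambda> \<Gamma>"
  have "?R \<subseteq> ?W \<times> ?W"
    unfolding restricted_rel_def using generated_step by fast
  moreover have "?W \<subseteq> partial_vals L \<Lambda>"
    using restricted_val_partial_vals mcs_generated assms by blast
  moreover have "(restricted_val L \<Lambda> \<Delta> \<beta> \<in> Pset \<longrightarrow> (\<exists>w\<in>?W. (restricted_val L \<Lambda> \<Delta>, w) \<in> ?R \<and> w \<beta> \<in> Des)) \<and>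
      (restricted_val L \<Lambda> \<Delta> \<beta> \<in> PNset \<longrightarrow> (\<exists>w\<in>?W. (restricted_val L \<Lambda> \<Delta>, w) \<in> ?R \<and> w \<beta> \<notin> Des))"
    if "\<Delta> \<in> generated L \<Gamma>" "\<beta> \<in> \<Lambda>" for \<Delta> \<beta>
  proof -
    have "restricted_val L \<Lambda> \<Theta> \<in> ?W \<and> (restricted_val L \<Lambda> \<Delta>, restricted_val L \<Lambda> \<Theta>) \<in> ?R"
      if "\<Theta> \<in> sucs L \<Delta>" for \<Theta>
      using that \<open>\<Delta> \<in> generated L \<Gamma>\<close> generated_step unfolding restricted_rel_def by blast
    then show ?thesis
      using that(2) canonical_val_mem by (metis restricted_val_apply)
  qed
  moreover have "(v \<beta> \<in> Nset \<longrightarrow> w \<beta> \<in> Des) \<and> (v \<beta> \<in> Iset \<longrightarrow> w \<beta> \<notin> Des)"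
    if "(v, w) \<in> ?R" "\<beta> \<in> \<Lambda>" for v w \<beta>
    using that by (auto simp: restricted_rel_def restricted_val_apply canonical_val_mem)
  ultimately show ?thesis
    using assms(1) unfolding K_model_def pre_model_def by blast
qed

text \<open>The hypothesis is derivability because \<open>L_model\<close> also asks for derived
  schemes. Conditions on one edge follow by lifting that edge.\<close>

lemma scheme_cond_restricted:
  assumes S: "instances S \<subseteq> (theorems L :: 'p fm set)" and m: "mcs L (\<Gamma> :: 'p fm set)"
  shows "scheme_cond S \<Lambda> (restricted_val L \<Lambda> ` generated L \<Gamma>) (restricted_rel L \<Lambda> \<Gamma>)"
proof -
  have rel: "\<exists>\<Delta> \<Theta>. v = restricted_val L \<Lambda> \<Delta> \<and> w = restricted_val L \<Lambda> \<Theta> \<and>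
      \<Delta> \<in> generated L \<Gamma> \<and> (\<Delta>, \<Theta>) \<in> canonical L"
    if "(v, w) \<in> restricted_rel L \<Lambda> \<Gamma>" for v w
    using that unfolding restricted_rel_def by blast
  note vals = restricted_val_apply canonical_val_mem
  show ?thesis
  proof (cases S)
    case AxT
    have "(\<Delta>, \<Delta>) \<in> canonical L" if "\<Delta> \<in> generated L \<Gamma>" for \<Delta>
      using canonical_refl S mcs_generated[OF m that] unfolding AxT by blast
    then show ?thesis
      unfolding AxT by (auto simp: vals)
  next
    case AxD
    have "sucs L \<Delta> \<noteq> {}" if "\<Delta> \<in> generated L \<Gamma>" for \<Delta>
      using canonical_serial S mcs_generated[OF m that] unfolding AxD by blast
    then show ?thesis
      unfolding AxD by (fastforce simp: vals)
  next
    case AxB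
    note sym = canonical_sym[OF S[unfolded AxB]]
    have "(v \<beta> \<in> Des \<longrightarrow> w \<beta> \<in> Pset) \<and> (v \<beta> \<notin> Des \<longrightarrow> w \<beta> \<in> PNset)"
      if vw: "(v, w) \<in> restricted_rel L \<Lambda> \<Gamma>" and \<beta>: "\<beta> \<in> \<Lambda>" for v w \<beta>
    proof -
      obtain \<Delta> \<Theta> where "v = restricted_val L \<Lambda> \<Delta>" "w = restricted_val L \<Lambda> \<Theta>" "(\<Delta>, \<Theta>) \<in> canonical L"
        using rel[OF vw] by blast
      moreover from this have "\<Delta> \<in> sucs L \<Theta>"
        using sym by blast
      ultimately show ?thesis
        using \<beta> by (metis vals)
    qed
    then show ?thesis
      unfolding AxB by simp
  next
    case Ax4
    note trans = canonical_trans[OF S[unfolded Ax4]]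
    have "(v \<beta> \<in> Nset \<longrightarrow> w \<beta> \<in> Nset) \<and> (v \<beta> \<in> Iset \<longrightarrow> w \<beta> \<in> Iset)"
      if vw: "(v, w) \<in> restricted_rel L \<Lambda> \<Gamma>" and \<beta>: "\<beta> \<in> \<Lambda>" for v w \<beta>
    proof -
      obtain \<Delta> \<Theta> where "v = restricted_val L \<Lambda> \<Delta>" "w = restricted_val L \<Lambda> \<Theta>" "(\<Delta>, \<Theta>) \<in> canonical L"
        using rel[OF vw] by blast
      moreover from this have "sucs L \<Theta> \<subseteq> sucs L \<Delta>"
        using trans by blast
      ultimately show ?thesis
        using \<beta> by (auto simp: vals)
    qed
    then show ?thesis
      unfolding Ax4 by simp
  next
    case Ax5
    note euclid = canonical_euclidean[OF S[unfolded Ax5]]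
    have "(v \<beta> \<in> Pset \<longrightarrow> w \<beta> \<in> Pset) \<and> (v \<beta> \<in> PNset \<longrightarrow> w \<beta> \<in> PNset)"
      if vw: "(v, w) \<in> restricted_rel L \<Lambda> \<Gamma>" and \<beta>: "\<beta> \<in> \<Lambda>" for v w \<beta>
    proof -
      obtain \<Delta> \<Theta> where "v = restricted_val L \<Lambda> \<Delta>" "w = restricted_val L \<Lambda> \<Theta>" "(\<Delta>, \<Theta>) \<in> canonical L"
        using rel[OF vw] by blast
      moreover from this have "sucs L \<Delta> \<subseteq> sucs L \<Theta>"
        using euclid by blast
      ultimately show ?thesis
        using \<beta> by (auto simp: vals)
    qed
    \<comment> \<open>The edges on \<open>v\<close>, \<open>w\<close>, \<open>w'\<close> may lift to
      different worlds for \<open>w\<close> and so need not form a canonical path. Hence a claim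
      without paths: any two ends of edges agree on \<open>Nset\<close> and \<open>Iset\<close>,
      because their worlds have the same successors.\<close>
    moreover have "(w \<beta> \<in> Nset \<longrightarrow> w' \<beta> \<in> Nset) \<and> (w \<beta> \<in> Iset \<longrightarrow> w' \<beta> \<in> Iset)"
      if vw: "(v, w) \<in> restricted_rel L \<Lambda> \<Gamma>" "(v', w') \<in> restricted_rel L \<Lambda> \<Gamma>" and \<beta>: "\<beta> \<in> \<Lambda>" for v v' w w' \<beta>
    proof -
      have reach: "\<exists>\<Theta>. w = restricted_val L \<Lambda> \<Theta> \<and> (\<Gamma>, \<Theta>) \<in> (canonical L)\<^sup>+"
        if "(v, w) \<in> restricted_rel L \<Lambda> \<Gamma>" for v w
        using rel[OF that] unfolding generated_def by (auto intro: rtrancl_into_trancl1)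
      obtain \<Theta> \<Theta>' where \<Theta>: "w = restricted_val L \<Lambda> \<Theta>" "(\<Gamma>, \<Theta>) \<in> (canonical L)\<^sup>+"
        "w' = restricted_val L \<Lambda> \<Theta>'" "(\<Gamma>, \<Theta>') \<in> (canonical L)\<^sup>+"
        using reach[OF vw(1)] reach[OF vw(2)] by blast
      \<comment> \<open>Some successor of \<Gamma> exists, since \<Theta> is at least one step away;
        it serves as common reference for \<Theta> and \<Theta>'.\<close>
      obtain s where "(\<Gamma>, s) \<in> canonical L"
        using \<Theta>(2) by (meson tranclD)
      then have "sucs L \<Theta> = sucs L \<Theta>'"
        using euclidean_sucs_eq[OF euclid _ \<Theta>(2)] euclidean_sucs_eq[OF euclid _ \<Theta>(4)] by simp
      then show ?thesis
        using \<beta> by (simp add: \<Theta>(1,3) vals)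
    qed
    ultimately show ?thesis
      unfolding Ax5 scheme_cond.simps by blast
  qed
qed

theorem theorem6:
  fixes L :: modal_logic and \<Lambda> :: "'p fm set" and v :: "'p fm \<Rightarrow> tval"
  assumes "v \<in> level_valuations L" and "closed_subfms \<Lambda>"
  shows "partial_level_valuation L \<Lambda> (restrict v \<Lambda>)"
proof -
  let ?\<Gamma> = "{\<beta>. v \<beta> \<in> Des}"
  let ?W = "restricted_val L \<Lambda> ` generated L ?\<Gamma>" and ?R = "restricted_rel L \<Lambda> ?\<Gamma>"
  note m = mcs_level_valuation[OF assms(1)]
  have "L_model L \<Lambda> ?W ?R"
    unfolding L_model_def using K_model_restricted[OF assms(2) m] scheme_cond_restricted[OF _ m] by blast
  moreover have "restrict v \<Lambda> = restricted_val L \<Lambda> ?\<Gamma>"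
    using level_valuation_eq_canonical_val[OF assms(1)] by (simp add: restricted_val_def)
  moreover have "?\<Gamma> \<in> generated L ?\<Gamma>"
    by (simp add: generated_def)
  ultimately show ?thesis
    unfolding partial_level_valuation_def by blast
qed

end
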